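(* For every integer $n \geq 1$ there exists an $S_3$-symmetric probability distribution $\pi$ on the finite set $T=\{(a,b,c) \in \mathbb{Z}_{\geq 0}^3 : a+b+c = n\}$ such that its marginal $\mu(\pi)$ on $\{0,1,\ldots,n\}$ achieves the maximum entropy among all probability distributions on $\{0,1,\ldots,n\}$ with mean $n/3$.
   Context: The entropy of a probability distribution $\mu$ on a finite set $I$ is $\eta(\mu) = -\sum_{i\in I}\mu(i)\log \mu(i)$, where $\log$ is the natural logarithm and $0\log 0$ is interpreted as $0$. A probability distribution $\pi$ on $T$ is $S_3$-symmetric if $\pi(i_1,i_2,i_3)=\pi(i_{\sigma(1)},i_{\sigma(2)},i_{\sigma(3)})$ for every $(i_1,i_2,i_3)\in T$ and every permutation $\sigma\in S_3$. The marginal $\mu(\pi)$ is the distribution of the first coordinate: $\mu(\pi)(a)=\sum_{(b,c)\,:\,(a,b,c)\in T}\pi(a,b,c)$ for $a\in\{0,1,\ldots,n\}$. The mean of a probability distribution $\mu$ on $\{0,1,\ldots,n\}$ is $\sum_{i=0}^n i\,\mu(i)$. *)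

theory Defs
  imports "HOL-Probability.Probability" "HOL-Combinatorics.Permutations"
begin

text \<open>
  A probability distribution on a finite set is a \<^typ>\<open>'a pmf\<close> supported in that set.
\<close>

definition distribution_on :: "'a set \<Rightarrow> 'a pmf \<Rightarrow> bool" where
  "distribution_on I \<mu> \<longleftrightarrow> set_pmf \<mu> \<subseteq> I"

text \<open>The product makes a summand with probability 0 vanish, whatever the value of \<open>ln 0\<close>.\<close>

definition shannon_entropy :: "'a set \<Rightarrow> 'a pmf \<Rightarrow> real" where
  "shannon_entropy I \<mu> = - (\<Sum>i\<in>I. pmf \<mu> i * ln (pmf \<mu> i))"

definition mean :: "nat \<Rightarrow> nat pmf \<Rightarrow> real" where
  "mean n \<mu> = (\<Sum>i=0..n. real i * pmf \<mu> i)"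

definition T :: "nat \<Rightarrow> (nat \<times> nat \<times> nat) set" where
  "T n = {(a, b, c). a + b + c = n}"

text \<open>The coordinates of a triple are numbered 1, 2, 3; only these indices are used.\<close>

definition coord :: "'a \<times> 'a \<times> 'a \<Rightarrow> nat \<Rightarrow> 'a" where
  "coord t k = (case t of (a, b, c) \<Rightarrow> if k = 1 then a else if k = 2 then b else c)"

definition S3_symmetric :: "nat \<Rightarrow> (nat \<times> nat \<times> nat) pmf \<Rightarrow> bool" where
  "S3_symmetric n \<pi> \<longleftrightarrow>
    (\<forall>t \<in> T n. \<forall>\<sigma>. \<sigma> permutes {1, 2, 3} \<longrightarrow>
       pmf \<pi> t = pmf \<pi> (coord t (\<sigma> 1), coord t (\<sigma> 2), coord t (\<sigma> 3)))"

definition marginal :: "(nat \<times> nat \<times> nat) pmf \<Rightarrow> nat pmf" where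
  "marginal \<pi> = map_pmf fst \<pi>"

lemma pmf_marginal:
  assumes "distribution_on (T n) \<pi>"
  shows "pmf (marginal \<pi>) a = (\<Sum>(b, c) \<in> {(b, c). (a, b, c) \<in> T n}. pmf \<pi> (a, b, c))"
proof -
  let ?S = "{(b, c). (a, b, c) \<in> T n}"
  have "?S \<subseteq> {0..n} \<times> {0..n}"
    by (auto simp: T_def)
  then have fin: "finite ?S"
    by (rule finite_subset) simp
  have "pmf (marginal \<pi>) a = measure \<pi> (fst -` {a})"
    by (simp add: marginal_def pmf_map)
  also have "\<dots> = measure \<pi> (Pair a ` ?S)"
    using assms by (intro measure_pmf.finite_measure_eq_AE)
      (auto simp: AE_measure_pmf_iff distribution_on_def)
  also have "\<dots> = sum (pmf \<pi>) (Pair a ` ?S)"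
    using fin by (simp add: measure_measure_pmf_finite)
  also have "\<dots> = (\<Sum>p \<in> ?S. pmf \<pi> (a, p))"
    by (subst sum.reindex) (auto simp: inj_on_def)
  finally show ?thesis
    by (simp add: case_prod_unfold)
qed

definition max_entropy_with_mean :: "nat \<Rightarrow> real \<Rightarrow> nat pmf \<Rightarrow> bool" where
  "max_entropy_with_mean n m \<mu> \<longleftrightarrow>
    distribution_on {0..n} \<mu> \<and> mean n \<mu> = m \<and>
    (\<forall>\<nu>. distribution_on {0..n} \<nu> \<and> mean n \<nu> = m \<longrightarrow>
       shannon_entropy {0..n} \<nu> \<le> shannon_entropy {0..n} \<mu>)"

end

theory Submission
  imports Defs
begin

text \<open>
  By Gibbs' inequality the maximum is attained at \<open>\<mu> i = x ^ i / Z\<close> with \<open>x\<close> chosen so that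
  the mean is \<open>n / 3\<close>. Since \<open>x \<le> 1\<close>, this sequence is decreasing and convex. Every convex
  profile of mean \<open>n / 3\<close> is the marginal of a symmetric measure on the triples of sum \<open>n\<close>, by
  induction from \<open>n - 3\<close> to \<open>n\<close>: the triples with a zero coordinate receive weights
  \<open>h i = h (n - i)\<close> at \<open>(0, i, n - i)\<close> that use up the whole mass at \<open>0\<close>, \<open>n - 1\<close> and \<open>n\<close>
  and are constant, \<open>\<sigma> / 2\<close>, for \<open>2 \<le> i \<le> n - 2\<close>. What is left lives on triples with positive
  coordinates, and subtracting 1 from each coordinate gives a convex profile for \<open>n - 3\<close>. The mass
  at \<open>0\<close> determines \<open>\<sigma>\<close>; convexity and the mean condition give \<open>0 \<le> \<sigma> \<le> u (n - 2)\<close>.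
\<close>

section \<open>Summation by parts against convex sequences\<close>

lemma sum_linear: "(\<Sum>j\<le>k. 3 * real j - c) = (real k + 1) * (3 * real k / 2 - c)"
  by (induction k) (simp_all add: field_simps)

text \<open>Summing by parts twice leaves, besides the left-hand side,
  \<open>(w N - w (Suc N)) * B N\<close> and the second differences of \<open>w\<close> weighted by
  \<open>B\<close>, all nonnegative.\<close>

lemma convex_summation_lower_bound:
  fixes a w A B :: "nat \<Rightarrow> real"
  assumes A: "A 0 = 0" "\<And>k. A (Suc k) = A k + a (Suc k)"
    and B: "B 0 = 0" "\<And>k. B (Suc k) = B k + A (Suc k)"
    and B_nonneg: "\<And>k. k \<le> N \<Longrightarrow> 0 \<le> B k"
    and convex: "\<And>i. 1 \<le> i \<Longrightarrow> i < N \<Longrightarrow> 2 * w (i + 1) \<le> w i + w (i + 2)"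
    and decreasing: "1 \<le> N \<Longrightarrow> w (Suc N) \<le> w N"
  shows "w (Suc N) * A (Suc N) \<le> (\<Sum>i=1..Suc N. a i * w i)"
proof -
  have partial: "w (Suc M) * A (Suc M) + (w M - w (Suc M)) * B M \<le> (\<Sum>i=1..Suc M. a i * w i)"
    if "M \<le> N" for M
    using that
  proof (induction M)
    case 0
    show ?case by (simp add: A B)
  next
    case (Suc M)
    have "(w (Suc M) - w (Suc (Suc M))) * B M \<le> (w M - w (Suc M)) * B M"
    proof (cases "M = 0")
      case True
      then show ?thesis by (simp add: B)
    next
      case False
      then show ?thesis
        using convex[of M] B_nonneg[of M] Suc.prems by (intro mult_right_mono) auto
    qed
    moreover have "w (Suc M) * A (Suc M) + (w M - w (Suc M)) * B M \<le> (\<Sum>i=1..Suc M. a i * w i)"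
      using Suc by simp
    ultimately show ?case
      by (simp add: A(2)[of "Suc M"] B(2)[of M] algebra_simps)
  qed
  have "0 \<le> (w N - w (Suc N)) * B N"
    by (cases "N = 0") (use B B_nonneg[of N] decreasing in auto)
  with partial[of N] show ?thesis by simp
qed

section \<open>Convex profiles and the bounds on their mass at 0\<close>

text \<open>
  The value at 0 is exempt from monotonicity and convexity and may fall below its convex bound
  \<open>2 * u 1 - u 2\<close> by as much as \<open>u n\<close>; this slack is what makes the class stable under
  the reduction from \<open>n\<close> to \<open>n - 3\<close>.
\<close>

definition convex_profile :: "nat \<Rightarrow> (nat \<Rightarrow> real) \<Rightarrow> bool" where
  "convex_profile n u \<longleftrightarrow>
    (\<forall>i\<le>n. 0 \<le> u i) \<and>
    (\<forall>i. 1 \<le> i \<and> i < n \<longrightarrow> u (i + 1) \<le> u i) \<and>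
    (\<forall>i. 1 \<le> i \<and> i + 2 \<le> n \<longrightarrow> 2 * u (i + 1) \<le> u i + u (i + 2)) \<and>
    (2 \<le> n \<longrightarrow> 2 * u 1 \<le> u 0 + u 2 + u n) \<and>
    (\<Sum>i\<le>n. (3 * real i - real n) * u i) = 0"

lemma convex_profile_mean:
  assumes "convex_profile (m + 3) u"
  shows "(real m + 3) * u 0 = (\<Sum>i=1..Suc m. (3 * real i - real (m + 3)) * u i)
    + (2 * real m + 3) * u (m + 2) + (2 * real m + 6) * u (m + 3)"
proof -
  have "(\<Sum>i\<le>m + 3. (3 * real i - real (m + 3)) * u i) = 0"
    using assms by (simp add: convex_profile_def)
  moreover have "sum f {..m + 3} = f 0 + (\<Sum>i=1..Suc m. f i) + f (m + 2) + f (m + 3)"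
    for f :: "nat \<Rightarrow> real"
  proof -
    have "{..m + 3} = insert 0 {1..Suc (Suc (Suc m))}" by auto
    then show ?thesis by (simp add: numeral_eq_Suc)
  qed
  ultimately show ?thesis by (simp add: algebra_simps)
qed

text \<open>Bounds \<open>\<sigma>\<close> from above. The negated mean coefficients have
  nonnegative double partial sums, so \<open>S\<close> is at most its value for the constant
  \<open>u (m + 1)\<close>.\<close>

lemma convex_profile_zero_upper:
  assumes "convex_profile (m + 3) u"
  shows "2 * (u 0 - 2 * u (m + 3) - u (m + 2)) \<le> real m * u (m + 1)"
proof -
  define S where "S = (\<Sum>i=1..Suc m. (3 * real i - real (m + 3)) * u i)"
  have B_nonneg: "0 \<le> real k * (real k + 1) * (real m + 1 - real k) / 2" if "k \<le> m" for k
    using that by (intro divide_nonneg_pos mult_nonneg_nonneg) auto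
  have "u (Suc m) * (- (real (Suc m) * (3 * real (Suc m) - 2 * real m - 3) / 2))
      \<le> (\<Sum>i=1..Suc m. (real (m + 3) - 3 * real i) * u i)"
    by (rule convex_summation_lower_bound
        [where A = "\<lambda>k. - (real k * (3 * real k - 2 * real m - 3) / 2)"
          and B = "\<lambda>k. real k * (real k + 1) * (real m + 1 - real k) / 2"])
      (use assms B_nonneg in \<open>auto simp: convex_profile_def field_simps\<close>)
  also have "\<dots> = - S"
    unfolding S_def sum_negf[symmetric] by (rule sum.cong) (auto simp: algebra_simps)
  finally have "2 * S \<le> real m * (real m + 1) * u (m + 1)"
    by (simp add: algebra_simps)
  moreover have "real m * u (m + 2) \<le> real m * u (m + 1)"
    using assms by (intro mult_left_mono) (auto simp: convex_profile_def)
  ultimately have "(real m + 3) * (2 * (u 0 - 2 * u (m + 3) - u (m + 2)))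
      \<le> (real m + 3) * (real m * u (m + 1))"
    using convex_profile_mean[OF assms] by (simp add: S_def algebra_simps)
  then show ?thesis by (rule mult_left_le_imp_le) simp
qed

text \<open>Gives \<open>0 \<le> \<sigma>\<close>. The double partial sums of the mean coefficients
  have the wrong sign here, so the slack condition at 0 is mixed in.\<close>

lemma convex_profile_zero_lower:
  assumes "convex_profile (m + 3) u"
  shows "0 \<le> u 0 - 2 * u (m + 3) - u (m + 2)"
proof (cases "m = 0")
  case True
  then show ?thesis using convex_profile_mean[OF assms] by simp
next
  case False
  then have m: "1 \<le> real m" by simp
  define S where "S = (\<Sum>i=1..Suc m. (3 * real i - real (m + 3)) * u i)"
  define c where "c = real (m + 3) * real m"
  \<comment> \<open>With \<open>n = m + 3\<close>, \<open>?A\<close> and \<open>?B\<close> are the iterated partial sums of the coefficients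
    \<open>a i\<close> in 6 times the mean condition plus \<open>n * (n - 3)\<close> times the slack condition at 0;
    these multipliers make \<open>?B\<close> nonnegative.\<close>
  let ?e = "\<lambda>i::nat. if i = 1 then 2 else if i = 2 then - 1 else (0::real)"
  let ?A = "\<lambda>k. 3 * (real k * (3 * real k - 2 * real m - 3))
    + c * (if k = 0 then 0 else if k = 1 then 2 else 1)"
  let ?B = "\<lambda>k. - 3 * real k * (real k + 1) * (real m + 1 - real k)
    + c * (if k = 0 then 0 else real k + 1)"
  have B_nonneg: "0 \<le> ?B k" for k
  proof (cases "k = 0")
    case False
    \<comment> \<open>Completing the square in \<open>k\<close> leaves a constant that is
      nonnegative because \<open>1 \<le> m\<close>.\<close>
    have "m \<le> m * m" by simp
    then have "real m \<le> real m * real m" by (simp flip: of_nat_mult)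
    then have "0 \<le> 3 * (2 * real k - (real m + 1))\<^sup>2 + (real m * real m + 6 * real m - 3)"
      using m by (intro add_nonneg_nonneg) (simp, linarith)
    also have "\<dots> = 4 * (c - 3 * real k * (real m + 1 - real k))"
      by (simp add: c_def power2_eq_square algebra_simps)
    finally have "0 \<le> (real k + 1) * (c - 3 * real k * (real m + 1 - real k))" by simp
    with False show ?thesis by (simp add: algebra_simps)
  qed simp
  have "u (Suc m) * ?A (Suc m) \<le>
      (\<Sum>i=1..Suc m. (6 * (3 * real i - real (m + 3)) + c * ?e i) * u i)"
    by (rule convex_summation_lower_bound[where A = ?A and B = ?B])
      (use assms B_nonneg in \<open>auto simp: convex_profile_def algebra_simps\<close>)
  also have "\<dots> = 6 * S + c * (\<Sum>i=1..Suc m. ?e i * u i)"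
    unfolding S_def sum_distrib_left sum.distrib[symmetric]
    by (rule sum.cong) (auto simp: algebra_simps)
  also have "(\<Sum>i=1..Suc m. ?e i * u i) = (\<Sum>i\<in>{1,2}. ?e i * u i)"
    using False by (intro sum.mono_neutral_right) auto
  also have "\<dots> = 2 * u 1 - u 2" by simp
  finally have "real m * (4 * real m + 6) * u (m + 1) \<le> 6 * S + c * (2 * u 1 - u 2)"
    using False by (simp add: c_def algebra_simps)
  also have "c * (2 * u 1 - u 2) \<le> c * (u 0 + u (m + 3))"
    using assms by (intro mult_left_mono) (auto simp: c_def convex_profile_def)
  finally have main: "real m * (4 * real m + 6) * u (m + 1) \<le> 6 * S + c * (u 0 + u (m + 3))"
    by simp
  have decreasing: "1 \<le> i \<Longrightarrow> i < m + 3 \<Longrightarrow> u (i + 1) \<le> u i" for i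
    using assms by (simp add: convex_profile_def)
  have "u (m + 2) \<le> u (m + 1)" "u (m + 3) \<le> u (m + 2)"
    using decreasing[of "m + 1"] decreasing[of "m + 2"] by (simp_all add: numeral_eq_Suc)
  then have "real m * (4 * real m + 6) * u (m + 2) \<le> real m * (4 * real m + 6) * u (m + 1)"
    "3 * c * u (m + 3) \<le> 3 * c * u (m + 2)"
    by (auto intro!: mult_left_mono simp: c_def)
  \<comment> \<open>\<open>u 0\<close> enters through both combined conditions, hence the factor
    \<open>6 * (m + 3) + c = (m + 3) * (m + 6)\<close>.\<close>
  with main have "((real m + 3) * (real m + 6)) * 0
      \<le> ((real m + 3) * (real m + 6)) * (u 0 - 2 * u (m + 3) - u (m + 2))"
    using convex_profile_mean[OF assms] by (simp add: S_def c_def algebra_simps)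
  then show ?thesis by (rule mult_left_le_imp_le) (intro mult_pos_pos; simp)
qed

text \<open>The boundary layer takes \<open>\<sigma>\<close> from the mass at each \<open>i\<close>
  with \<open>2 \<le> i \<le> m + 1\<close>, but \<open>u (m + 2)\<close> at \<open>i = 1\<close>,
  where symmetry mirrors the weight at \<open>m + 2\<close>. Hence the separate value at 0 after the
  shift.\<close>

lemma convex_profile_remainder:
  assumes u: "convex_profile (m + 3) u"
    and \<sigma>: "real m * \<sigma> = 2 * (u 0 - 2 * u (m + 3) - u (m + 2))" "\<sigma> \<le> u (m + 1)"
  shows "convex_profile m (\<lambda>j. if j = 0 then u 1 - u (m + 2) else u (j + 1) - \<sigma>)"
    (is "convex_profile m ?v")
proof -
  have decreasing: "u (i + 1) \<le> u i" if "1 \<le> i" "i < m + 3" for i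
    using u that by (simp add: convex_profile_def)
  have convex: "2 * u (i + 1) \<le> u i + u (i + 2)" if "1 \<le> i" "i \<le> m + 1" for i
    using u that by (simp add: convex_profile_def)
  have antimono: "u j \<le> u i" if "1 \<le> i" "i \<le> j" "j \<le> m + 3" for i j
    using that(2,3)
  proof (induction j rule: dec_induct)
    case (step j)
    then show ?case using decreasing[of j] that(1) by simp
  qed simp
  have nonneg: "0 \<le> ?v j" if "j \<le> m" for j
    using that \<sigma>(2) antimono[of 1 "m + 2"] antimono[of "j + 1" "m + 1"] by auto
  \<comment> \<open>Subtract \<open>\<sigma>\<close> everywhere, then correct the term
    \<open>j = 0\<close>, whose coefficient is \<open>- m\<close>.\<close>
  have "(\<Sum>j\<le>m. (3 * real j - real m) * ?v j) =
      (\<Sum>j\<le>m. (3 * real j - real m) * u (j + 1)) - \<sigma> * (\<Sum>j\<le>m. 3 * real j - real m)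
        + (\<Sum>j\<le>m. if j = 0 then - real m * (\<sigma> - u (m + 2)) else 0)"
    unfolding sum_distrib_left sum_subtractf[symmetric] sum.distrib[symmetric]
    by (rule sum.cong) (auto simp: algebra_simps)
  also have "(\<Sum>j\<le>m. (3 * real j - real m) * u (j + 1)) =
      (\<Sum>i=1..Suc m. (3 * real i - real (m + 3)) * u i)"
    by (rule sum.reindex_bij_witness[where i = "\<lambda>i. i - 1" and j = Suc]) auto
  also have "\<dots> = (real m + 3) * u 0 - (2 * real m + 3) * u (m + 2) - (2 * real m + 6) * u (m + 3)"
    using convex_profile_mean[OF u] by simp
  also have "(\<Sum>j\<le>m. if j = 0 then - real m * (\<sigma> - u (m + 2)) else 0) =
      - real m * \<sigma> + real m * u (m + 2)"
    by (simp add: algebra_simps)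
  also have "(real m + 3) * u 0 - (2 * real m + 3) * u (m + 2) - (2 * real m + 6) * u (m + 3)
      - \<sigma> * (\<Sum>j\<le>m. 3 * real j - real m) + (- real m * \<sigma> + real m * u (m + 2)) =
      (real m + 3) * ((u 0 - 2 * u (m + 3) - u (m + 2)) - real m * \<sigma> / 2)"
    unfolding sum_linear by (simp add: field_simps)
  also have "\<dots> = 0" by (simp add: \<sigma>(1))
  finally have mean_zero: "(\<Sum>j\<le>m. (3 * real j - real m) * ?v j) = 0" .
  \<comment> \<open>\<open>?v 0\<close> differs from \<open>u 1 - \<sigma>\<close> by
    \<open>u (m + 2) - \<sigma>\<close>, which the slack term
    \<open>?v m = u (m + 1) - \<sigma>\<close> covers.\<close>
  have zero: "2 * ?v 1 \<le> ?v 0 + ?v 2 + ?v m" if "2 \<le> m"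
    using that convex[of 1] convex[of "m + 1"] antimono[of "m + 1" "m + 2"] decreasing[of "m + 1"]
    by (simp add: numeral_eq_Suc)
  show ?thesis
    unfolding convex_profile_def
    using nonneg mean_zero zero decreasing convex by auto
qed

lemma convex_profile_layer:
  assumes "convex_profile (m + 3) u"
  obtains \<sigma> where "0 \<le> \<sigma>" "\<sigma> \<le> u (m + 1)"
    "real m * \<sigma> = 2 * (u 0 - 2 * u (m + 3) - u (m + 2))"
proof
  \<comment> \<open>For \<open>m = 0\<close> the quotient is 0 by convention, and the two bounds
    make the numerator 0 as well.\<close>
  let ?\<sigma> = "2 * (u 0 - 2 * u (m + 3) - u (m + 2)) / real m"
  note bounds = convex_profile_zero_lower[OF assms] convex_profile_zero_upper[OF assms]
  show "0 \<le> ?\<sigma>" using bounds by simp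
  show "?\<sigma> \<le> u (m + 1)"
  proof (cases "m = 0")
    case True
    then show ?thesis using assms by (simp add: convex_profile_def)
  next
    case False
    then show ?thesis using bounds by (simp add: field_simps)
  qed
  show "real m * ?\<sigma> = 2 * (u 0 - 2 * u (m + 3) - u (m + 2))"
    using bounds by (cases "m = 0") auto
qed

section \<open>Symmetric measures with a prescribed marginal\<close>

text \<open>The two adjacent transpositions generate \<open>S_3\<close>. The total mass is left free
  because the induction peels mass off.\<close>

definition symmetric_coupling :: "nat \<Rightarrow> (nat \<Rightarrow> real) \<Rightarrow> (nat \<Rightarrow> nat \<Rightarrow> nat \<Rightarrow> real) \<Rightarrow> bool" where
  "symmetric_coupling n u p \<longleftrightarrow>
    (\<forall>a b c. a + b + c = n \<longrightarrow> 0 \<le> p a b c \<and> p a b c = p b a c \<and> p a b c = p a c b) \<and>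
    (\<forall>i\<le>n. (\<Sum>b\<le>n - i. p i b (n - i - b)) = u i)"

text \<open>\<open>h\<close> fills the triples with a zero coordinate, the shifted \<open>q\<close>
  all others. By \<open>h_sym\<close> it does not matter which of the other two coordinates is
  passed to \<open>h\<close>.\<close>

lemma symmetric_coupling_extend:
  assumes q: "symmetric_coupling m v q"
    and h_nonneg: "\<And>i. i \<le> m + 3 \<Longrightarrow> 0 \<le> h i"
    and h_sym: "\<And>i j. i + j = m + 3 \<Longrightarrow> h i = h j"
    and h_zero: "(\<Sum>i\<le>m + 3. h i) = u 0"
    and h_top: "h (m + 3) = u (m + 3)" "2 * h (m + 2) = u (m + 2)"
    and h_middle: "\<And>j. j \<le> m \<Longrightarrow> 2 * h (j + 1) + v j = u (j + 1)"
  shows "symmetric_coupling (m + 3) u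
    (\<lambda>a b c. if a = 0 then h b else if b = 0 \<or> c = 0 then h a else q (a - 1) (b - 1) (c - 1))"
    (is "symmetric_coupling _ _ ?p")
  unfolding symmetric_coupling_def
proof (intro conjI allI impI)
  fix a b c :: nat
  assume abc: "a + b + c = m + 3"
  have q': "0 \<le> q a' b' c' \<and> q a' b' c' = q b' a' c' \<and> q a' b' c' = q a' c' b'"
    if "a' + b' + c' = m" for a' b' c'
    using q that by (simp add: symmetric_coupling_def)
  have "0 \<le> ?p a b c \<and> ?p a b c = ?p b a c \<and> ?p a b c = ?p a c b"
  proof (cases "a = 0 \<or> b = 0 \<or> c = 0")
    case True
    then show ?thesis
      using abc h_nonneg[of a] h_nonneg[of b] h_sym[of a b] h_sym[of a c] h_sym[of b c] by auto
  next
    case False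
    then show ?thesis using q'[of "a - 1" "b - 1" "c - 1"] abc by auto
  qed
  then show "0 \<le> ?p a b c" "?p a b c = ?p b a c" "?p a b c = ?p a c b" by blast+
next
  have q_marginal: "(\<Sum>b\<le>m - j. q j b (m - j - b)) = v j" if "j \<le> m" for j
    using q that unfolding symmetric_coupling_def by blast
  fix i assume i: "i \<le> m + 3"
  \<comment> \<open>Rows \<open>m + 3\<close> and \<open>m + 2\<close> consist of one and two
    boundary triples; rows \<open>1\<close> to \<open>m + 1\<close> have two boundary triples
    besides the interior.\<close>
  consider "i = 0" | "i = m + 3" | "i = m + 2" | "1 \<le> i" "i \<le> m + 1"
    using i by linarith
  then show "(\<Sum>b\<le>m + 3 - i. ?p i b (m + 3 - i - b)) = u i"
  proof cases
    case 1
    then show ?thesis using h_zero by simp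
  next
    case 2
    then show ?thesis using h_top by simp
  next
    case 3
    then show ?thesis using h_top by simp
  next
    case 4
    define j k where "j = i - 1" and "k = m - j"
    with 4 have jk: "i = Suc j" "m = j + k" by auto
    have split: "sum f {..Suc (Suc k)} = f 0 + (\<Sum>b\<le>k. f (Suc b)) + f (Suc (Suc k))"
      for f :: "nat \<Rightarrow> real"
      using sum.atMost_Suc_shift[of f k] by simp
    have "m + 3 - i = Suc (Suc k)" using jk by simp
    then have "(\<Sum>b\<le>m + 3 - i. ?p i b (m + 3 - i - b)) =
        2 * h i + (\<Sum>b\<le>k. ?p i (Suc b) (Suc k - b))"
      by (simp only: split) (simp add: jk)
    also have "(\<Sum>b\<le>k. ?p i (Suc b) (Suc k - b)) = (\<Sum>b\<le>m - j. q j b (m - j - b))"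
      using jk by (intro sum.cong) (auto simp: Suc_diff_le)
    also have "2 * h i + \<dots> = u i"
      using jk q_marginal[of j] h_middle[of j] by simp
    finally show ?thesis .
  qed
qed

lemma convex_profile_symmetric_coupling:
  assumes "convex_profile n u"
  shows "\<exists>p. symmetric_coupling n u p"
  using assms
proof (induction n arbitrary: u rule: less_induct)
  case (less n)
  have u: "(\<Sum>i\<le>n. (3 * real i - real n) * u i) = 0" "\<And>i. i \<le> n \<Longrightarrow> 0 \<le> u i"
    using less.prems by (auto simp: convex_profile_def)
  \<comment> \<open>For \<open>n = 1\<close> and \<open>n = 2\<close> symmetry and the masses at
    positive coordinates fix the weights; the mean condition then yields the mass at 0.\<close>
  consider "n = 0" | "n = 1" | "n = 2" | "3 \<le> n" by linarith
  then show ?case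
  proof cases
    case 1
    then have "symmetric_coupling n u (\<lambda>_ _ _. u 0)"
      using u by (simp add: symmetric_coupling_def)
    then show ?thesis by blast
  next
    case 2
    then have "symmetric_coupling n u (\<lambda>_ _ _. u 1)"
      using u by (auto simp: symmetric_coupling_def le_Suc_eq)
    then show ?thesis by blast
  next
    case 3
    then have "symmetric_coupling n u
        (\<lambda>a b c. if a = 2 \<or> b = 2 \<or> c = 2 then u 2 else u 1 / 2)"
      using u by (auto simp: symmetric_coupling_def le_Suc_eq numeral_eq_Suc)
    then show ?thesis by blast
  next
    case 4
    define m where "m = n - 3"
    with 4 have n: "n = m + 3" by simp
    with less.prems have prof: "convex_profile (m + 3) u" by simp
    then obtain \<sigma> where \<sigma>: "0 \<le> \<sigma>" "\<sigma> \<le> u (m + 1)"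
      "real m * \<sigma> = 2 * (u 0 - 2 * u (m + 3) - u (m + 2))"
      by (rule convex_profile_layer)
    obtain q where q: "symmetric_coupling m
        (\<lambda>j. if j = 0 then u 1 - u (m + 2) else u (j + 1) - \<sigma>) q"
      using less.IH[OF _ convex_profile_remainder[OF prof \<sigma>(3,2)]] n by auto
    \<comment> \<open>The masses at \<open>m + 3\<close> and \<open>m + 2\<close> fix
      \<open>h\<close> there and, by reflection, at 0 and 1; the other \<open>m\<close> places share
      the rest of \<open>u 0\<close> equally.\<close>
    define h where "h i = (if i = 0 \<or> i = m + 3 then u (m + 3)
      else if i = 1 \<or> i = m + 2 then u (m + 2) / 2 else \<sigma> / 2)" for i
    have "(\<Sum>i\<le>m + 3. h i) =
        (\<Sum>i\<in>insert 0 (insert 1 (insert (m + 2) (insert (m + 3) {2..m + 1}))). h i)"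
      by (rule sum.cong) auto
    also have "\<dots> = 2 * u (m + 3) + u (m + 2) + (\<Sum>i=2..m + 1. h i)"
      by (simp add: h_def)
    also have "(\<Sum>i=2..m + 1. h i) = (\<Sum>i=2..m + 1. \<sigma> / 2)"
      by (rule sum.cong) (auto simp: h_def)
    also have "2 * u (m + 3) + u (m + 2) + \<dots> = u 0"
      using \<sigma>(3) by (simp add: field_simps)
    finally have h_zero: "(\<Sum>i\<le>m + 3. h i) = u 0" .
    show ?thesis
      unfolding n
      by (rule exI, rule symmetric_coupling_extend[OF q, where h = h])
        (use u(2) n \<sigma>(1) h_zero in \<open>auto simp: h_def\<close>)
  qed
qed

section \<open>Geometric distributions and maximum entropy\<close>

text \<open>The sum is \<open>- n\<close> at \<open>x = 0\<close>, where \<open>0 ^ 0 = 1\<close>,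
  and \<open>n * (n + 1) / 2\<close> at \<open>x = 1\<close>, so it has a root in between.\<close>

lemma geometric_mean_exists:
  assumes "1 \<le> n"
  obtains x :: real where "0 < x" "x \<le> 1" "(\<Sum>i\<le>n. (3 * real i - real n) * x ^ i) = 0"
proof -
  let ?f = "\<lambda>x::real. \<Sum>i\<le>n. (3 * real i - real n) * x ^ i"
  have at_1: "0 \<le> ?f 1" by (simp add: sum_linear)
  have "?f 0 = (\<Sum>i\<le>n. if i = 0 then - real n else 0)"
    by (rule sum.cong) auto
  then have at_0: "?f 0 < 0" using assms by simp
  have "continuous_on {0..1} ?f" by (intro continuous_intros)
  then obtain x where x: "0 \<le> x" "x \<le> 1" "?f x = 0"
    using IVT'[of ?f 0 0 1] at_0 at_1 by auto
  moreover have "x \<noteq> 0" using x at_0 by auto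
  ultimately show thesis using that[of x] by simp
qed

lemma convex_profile_geometric:
  fixes x Z :: real
  assumes "0 < x" "x \<le> 1" "0 < Z" "(\<Sum>i\<le>n. (3 * real i - real n) * x ^ i) = 0"
  shows "convex_profile n (\<lambda>i. x ^ i / Z)"
proof -
  have convex: "2 * (x ^ (i + 1) / Z) \<le> x ^ i / Z + x ^ (i + 2) / Z" for i
  proof -
    have "0 \<le> x ^ i * (x - 1)\<^sup>2 / Z" using assms by simp
    then show ?thesis
      by (simp add: power2_eq_square algebra_simps add_divide_distrib diff_divide_distrib)
  qed
  have "(\<Sum>i\<le>n. (3 * real i - real n) * (x ^ i / Z)) = (\<Sum>i\<le>n. (3 * real i - real n) * x ^ i) / Z"
    by (simp add: sum_divide_distrib)
  also have "\<dots> = 0" by (simp add: assms(4))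
  finally have "(\<Sum>i\<le>n. (3 * real i - real n) * (x ^ i / Z)) = 0" .
  moreover have "x ^ (i + 1) / Z \<le> x ^ i / Z" for i
    using assms by (intro divide_right_mono power_decreasing) auto
  moreover have nonneg: "0 \<le> x ^ i / Z" for i
    using assms by simp
  moreover have "2 * (x ^ 1 / Z) \<le> x ^ 0 / Z + x ^ 2 / Z + x ^ n / Z"
    using convex[of 0] nonneg[of n] by (simp add: power2_eq_square)
  ultimately show ?thesis
    using convex unfolding convex_profile_def by blast
qed

text \<open>As \<open>ln (pmf \<mu> i)\<close> is affine in \<open>i\<close>, the sum in
  \<open>cross\<close> is the same for every competitor and for \<open>\<mu>\<close> itself.\<close>

lemma geometric_max_entropy:
  assumes \<mu>: "distribution_on {0..n} \<mu>" "mean n \<mu> = m"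
    and geometric: "0 < x" "0 < Z" "\<And>i. i \<le> n \<Longrightarrow> pmf \<mu> i = x ^ i / Z"
  shows "max_entropy_with_mean n m \<mu>"
  unfolding max_entropy_with_mean_def
proof (intro conjI allI impI)
  have total: "(\<Sum>i=0..n. pmf \<nu> i) = 1" if "distribution_on {0..n} \<nu>" for \<nu>
    using that by (intro sum_pmf_eq_1) (auto simp: distribution_on_def)
  have cross: "(\<Sum>i=0..n. pmf \<nu> i * ln (pmf \<mu> i)) = m * ln x - ln Z"
    if "distribution_on {0..n} \<nu>" "mean n \<nu> = m" for \<nu>
  proof -
    have "(\<Sum>i=0..n. pmf \<nu> i * ln (pmf \<mu> i)) =
        (\<Sum>i=0..n. (real i * pmf \<nu> i) * ln x - pmf \<nu> i * ln Z)"
      using geometric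
      by (intro sum.cong) (auto simp: ln_div ln_realpow algebra_simps)
    also have "\<dots> = mean n \<nu> * ln x - (\<Sum>i=0..n. pmf \<nu> i) * ln Z"
      by (simp add: sum_subtractf mean_def sum_distrib_right)
    finally show ?thesis using that total by simp
  qed
  fix \<nu> assume \<nu>: "distribution_on {0..n} \<nu> \<and> mean n \<nu> = m"
  \<comment> \<open>Gibbs' inequality termwise, from \<open>ln t \<le> t - 1\<close> at the ratio of
    the masses; the left-hand sides sum to 0.\<close>
  have "pmf \<nu> i - pmf \<mu> i \<le> pmf \<nu> i * ln (pmf \<nu> i) - pmf \<nu> i * ln (pmf \<mu> i)"
    if "i \<le> n" for i
  proof (cases "pmf \<nu> i = 0")
    case False
    then have pos: "0 < pmf \<nu> i" "0 < pmf \<mu> i"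
      using geometric that by (simp_all add: pmf_pos)
    then have "pmf \<nu> i * ln (pmf \<mu> i / pmf \<nu> i) \<le> pmf \<nu> i * (pmf \<mu> i / pmf \<nu> i - 1)"
      by (intro mult_left_mono ln_le_minus_one) auto
    with pos show ?thesis by (simp add: ln_div right_diff_distrib)
  qed simp
  then have "(\<Sum>i=0..n. pmf \<nu> i - pmf \<mu> i) \<le>
      (\<Sum>i=0..n. pmf \<nu> i * ln (pmf \<nu> i) - pmf \<nu> i * ln (pmf \<mu> i))"
    by (intro sum_mono) auto
  then show "shannon_entropy {0..n} \<nu> \<le> shannon_entropy {0..n} \<mu>"
    using total[of \<nu>] total[OF \<mu>(1)] cross[of \<nu>] cross[of \<mu>] \<mu> \<nu>
    by (simp add: shannon_entropy_def sum_subtractf)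
qed (use \<mu> in auto)

section \<open>From couplings to probability distributions\<close>

lemma symmetric_coupling_pmf:
  assumes p: "symmetric_coupling n u p" and total: "(\<Sum>i\<le>n. u i) = 1"
  obtains \<pi> where "distribution_on (T n) \<pi>" "S3_symmetric n \<pi>"
    "\<And>i. i \<le> n \<Longrightarrow> pmf (marginal \<pi>) i = u i"
proof -
  define f where "f t = (if t \<in> T n then (case t of (a, b, c) \<Rightarrow> p a b c) else 0)" for t
  have T_eq: "T n = (\<lambda>(i, b). (i, b, n - i - b)) ` (SIGMA i:{..n}. {..n - i})"
    by (auto simp: T_def image_iff)
  have fin: "finite (T n)" unfolding T_eq by simp
  have sym: "0 \<le> p a b c \<and> p a b c = p b a c \<and> p a b c = p a c b" if "a + b + c = n" for a b c
    using p that by (simp add: symmetric_coupling_def)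
  have nonneg: "0 \<le> f t" for t
    using sym by (auto simp: f_def T_def split: prod.splits)
  have "sum f (T n) = (\<Sum>(i, b)\<in>(SIGMA i:{..n}. {..n - i}). f (i, b, n - i - b))"
    unfolding T_eq by (subst sum.reindex) (auto simp: inj_on_def case_prod_unfold)
  also have "\<dots> = (\<Sum>i\<le>n. \<Sum>b\<le>n - i. f (i, b, n - i - b))"
    by (subst sum.Sigma) auto
  also have "\<dots> = (\<Sum>i\<le>n. \<Sum>b\<le>n - i. p i b (n - i - b))"
    by (intro sum.cong) (auto simp: f_def T_def)
  also have "\<dots> = 1"
    using p total by (simp add: symmetric_coupling_def)
  finally have f_total: "sum f (T n) = 1" .
  have "(\<integral>\<^sup>+t. ennreal (f t) \<partial>count_space UNIV) = (\<Sum>t\<in>T n. ennreal (f t))"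
    using fin by (intro nn_integral_count_space') (auto simp: f_def)
  also have "\<dots> = 1"
    using f_total nonneg by (simp add: sum_ennreal)
  finally have pmf_f: "pmf (embed_pmf f) t = f t" for t
    using nonneg by (intro pmf_embed_pmf) auto
  define \<pi> where "\<pi> = embed_pmf f"
  have dist: "distribution_on (T n) \<pi>"
    by (auto simp: distribution_on_def \<pi>_def set_pmf_iff pmf_f f_def split: if_splits)
  moreover have "S3_symmetric n \<pi>"
    unfolding S3_symmetric_def
  proof (intro ballI allI impI)
    fix t \<sigma> assume t: "t \<in> T n" and \<sigma>: "\<sigma> permutes {1, 2, 3::nat}"
    obtain a b c where abc: "t = (a, b, c)" "a + b + c = n"
      using t by (cases t) (auto simp: T_def)
    \<comment> \<open>Only six value patterns of \<open>\<sigma>\<close> remain; the instances of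
      \<open>sym\<close> link each arrangement to \<open>p a b c\<close> by transpositions.\<close>
    have "\<sigma> 1 \<in> {1, 2, 3}" "\<sigma> 2 \<in> {1, 2, 3}" "\<sigma> 3 \<in> {1, 2, 3}"
      "\<sigma> 1 \<noteq> \<sigma> 2" "\<sigma> 1 \<noteq> \<sigma> 3" "\<sigma> 2 \<noteq> \<sigma> 3"
      using permutes_in_image[OF \<sigma>] permutes_inj[OF \<sigma>, THEN inj_eq] by auto
    then show "pmf \<pi> t = pmf \<pi> (coord t (\<sigma> 1), coord t (\<sigma> 2), coord t (\<sigma> 3))"
      using abc sym[of a b c] sym[of b c a] sym[of b a c] sym[of c a b] sym[of c b a]
      by (auto simp: \<pi>_def pmf_f f_def T_def coord_def)
  qed
  moreover have "pmf (marginal \<pi>) i = u i" if "i \<le> n" for i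
  proof -
    have "{(b, c). (i, b, c) \<in> T n} = (\<lambda>b. (b, n - i - b)) ` {..n - i}"
      using that by (auto simp: T_def image_iff)
    then have "pmf (marginal \<pi>) i = (\<Sum>b\<le>n - i. pmf \<pi> (i, b, n - i - b))"
      unfolding pmf_marginal[OF dist] by (simp add: sum.reindex inj_on_def)
    also have "\<dots> = (\<Sum>b\<le>n - i. p i b (n - i - b))"
      using that by (intro sum.cong) (auto simp: \<pi>_def pmf_f f_def T_def)
    also have "\<dots> = u i"
      using p that unfolding symmetric_coupling_def by blast
    finally show ?thesis .
  qed
  ultimately show thesis by (rule that)
qed

theorem theorem2:
  fixes n :: nat
  assumes "n \<ge> 1"
  shows "\<exists>\<pi>. distribution_on (T n) \<pi> \<and> S3_symmetric n \<pi> \<and>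
    max_entropy_with_mean n (real n / 3) (marginal \<pi>)"
proof -
  obtain x :: real where x: "0 < x" "x \<le> 1" "(\<Sum>i\<le>n. (3 * real i - real n) * x ^ i) = 0"
    using geometric_mean_exists[OF assms] by blast
  define Z where "Z = (\<Sum>i\<le>n. x ^ i)"
  have Z: "0 < Z" unfolding Z_def using x(1) by (intro sum_pos) auto
  obtain p where p: "symmetric_coupling n (\<lambda>i. x ^ i / Z) p"
    using convex_profile_symmetric_coupling[OF convex_profile_geometric[OF x(1,2) Z x(3)]] by blast
  have "(\<Sum>i\<le>n. x ^ i / Z) = 1"
    using Z by (simp add: Z_def flip: sum_divide_distrib)
  with p obtain \<pi> where \<pi>: "distribution_on (T n) \<pi>" "S3_symmetric n \<pi>"
    "\<And>i. i \<le> n \<Longrightarrow> pmf (marginal \<pi>) i = x ^ i / Z"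
    by (rule symmetric_coupling_pmf) blast
  have "3 * (\<Sum>i\<le>n. real i * x ^ i) = real n * Z"
    using x(3) by (simp add: Z_def sum_subtractf sum_distrib_left left_diff_distrib mult.assoc)
  then have "(\<Sum>i\<le>n. real i * x ^ i) / Z = real n / 3"
    using Z by (simp add: field_simps)
  then have "mean n (marginal \<pi>) = real n / 3"
    using \<pi>(3) by (simp add: mean_def atLeast0AtMost sum_divide_distrib)
  moreover have "distribution_on {0..n} (marginal \<pi>)"
    using \<pi>(1) by (fastforce simp: distribution_on_def marginal_def T_def)
  ultimately show ?thesis
    using \<pi> geometric_max_entropy[OF _ _ x(1) Z \<pi>(3)] by blast
qed

end
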